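(* Let $\mathcal R$ be a non-singular equivalence relation on a standard probability space $(X,\mu)$. Then its space $\mathrm{Sub}(\mathcal R)$ of subequivalence relations is a Polish space for the topology induced by the measure algebra $\mathrm{MAlg}(\mathcal R,M)$ of $\mathcal R$.
   Context: Standard probability spaces are atomless standard Borel probability spaces. A countable Borel equivalence relation (CBER) on $X$ is an equivalence relation $\mathcal R\subseteq X\times X$ that is a Borel subset and has countable classes. It is non-singular (with respect to $\mu$) if for every Borel bijection $\varphi$ between Borel subsets $\mathrm{dom}\,\varphi,\mathrm{rng}\,\varphi\subseteq X$ with $(x,\varphi(x))\in\mathcal R$ for all $x\in\mathrm{dom}\,\varphi$, one has $\mu(\mathrm{dom}\,\varphi)=0$ iff $\mu(\mathrm{rng}\,\varphi)=0$. Equip $\mathcal R$ with the $\sigma$-finite measure $M(A)=\int_X|A_x|\,d\mu(x)$ for Borel $A\subseteq\mathcal R$, where $A_x=\{y:(x,y)\in A\}$. $\mathrm{MAlg}(\mathcal R,M)$ is the set of Borel subsets of $\mathcal R$ modulo $M$-null symmetric difference, with the topology given by the metric $d_m(A,B)=m(A\triangle B)$, where $m$ is any finite measure with the same null sets as $M$ (the topology does not depend on the choice of $m$). $\mathrm{Sub}(\mathcal R)\subseteq\mathrm{MAlg}(\mathcal R,M)$ is the set of those elements whose class modulo null sets contains a Borel subset of $\mathcal R$ which is an equivalence relation on $X$; it carries the subspace topology. *)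

theory Defs
  imports "HOL-Probability.Probability"
begin

definition polish_topology :: "'a topology \<Rightarrow> bool" where
  "polish_topology T \<longleftrightarrow> completely_metrizable_space T \<and> separable_space T"

definition standard_borel :: "'a measure \<Rightarrow> bool" where
  "standard_borel \<mu> \<longleftrightarrow>
     (\<exists>T. polish_topology T \<and> topspace T = space \<mu> \<and>
          sets \<mu> = sigma_sets (space \<mu>) {U. openin T U})"

definition atomless :: "'a measure \<Rightarrow> bool" where
  "atomless \<mu> \<longleftrightarrow>
     (\<forall>A\<in>sets \<mu>. emeasure \<mu> A > 0 \<longrightarrow>
        (\<exists>B\<in>sets \<mu>. B \<subseteq> A \<and> 0 < emeasure \<mu> B \<and> emeasure \<mu> B < emeasure \<mu> A))"

definition standard_prob_space :: "'a measure \<Rightarrow> bool" where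
  "standard_prob_space \<mu> \<longleftrightarrow> prob_space \<mu> \<and> standard_borel \<mu> \<and> atomless \<mu>"

definition cber :: "'a measure \<Rightarrow> ('a \<times> 'a) set \<Rightarrow> bool" where
  "cber \<mu> R \<longleftrightarrow>
     equiv (space \<mu>) R \<and> R \<in> sets (\<mu> \<Otimes>\<^sub>M \<mu>) \<and> (\<forall>x\<in>space \<mu>. countable (R `` {x}))"

text \<open>A Borel bijection between Borel subsets of a standard Borel space has a Borel inverse, so
  measurability of the inverse need not be required.\<close>

definition nonsingular :: "'a measure \<Rightarrow> ('a \<times> 'a) set \<Rightarrow> bool" where
  "nonsingular \<mu> R \<longleftrightarrow>
     (\<forall>A\<in>sets \<mu>. \<forall>B\<in>sets \<mu>. \<forall>\<phi>.
        bij_betw \<phi> A B \<and> \<phi> \<in> measurable (restrict_space \<mu> A) (restrict_space \<mu> B) \<and>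
        (\<forall>x\<in>A. (x, \<phi> x) \<in> R) \<longrightarrow>
        (emeasure \<mu> A = 0 \<longleftrightarrow> emeasure \<mu> B = 0))"

text \<open>The cardinality of a section is its counting measure (infinite if the section is infinite).
  For a countable Borel equivalence relation the integrand is Borel, by the Lusin-Novikov theorem,
  so the set function below is indeed a measure on the Borel subsets of \<open>R\<close>.\<close>

definition rel_measure :: "'a measure \<Rightarrow> ('a \<times> 'a) set \<Rightarrow> ('a \<times> 'a) measure" where
  "rel_measure \<mu> R =
     measure_of R (sets (restrict_space (\<mu> \<Otimes>\<^sub>M \<mu>) R))
       (\<lambda>A. \<integral>\<^sup>+x. emeasure (count_space UNIV) {y. (x, y) \<in> A} \<partial>\<mu>)"

definition null_equiv :: "'b measure \<Rightarrow> ('b set \<times> 'b set) set" where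
  "null_equiv M = {(A, B). A \<in> sets M \<and> B \<in> sets M \<and> sym_diff A B \<in> null_sets M}"

definition malg :: "'b measure \<Rightarrow> 'b set set set" where
  "malg M = sets M // null_equiv M"

definition equivalent_finite_measure :: "'b measure \<Rightarrow> 'b measure \<Rightarrow> bool" where
  "equivalent_finite_measure M m \<longleftrightarrow>
     finite_measure m \<and> sets m = sets M \<and> null_sets m = null_sets M"

text \<open>The value does not depend on the representatives if \<open>m\<close> has the same null sets as the measure
  that defines the classes.\<close>

definition malg_dist :: "'b measure \<Rightarrow> 'b set set \<Rightarrow> 'b set set \<Rightarrow> real" where
  "malg_dist m a b = measure m (sym_diff (SOME A. A \<in> a) (SOME B. B \<in> b))"

definition malg_topology :: "'b measure \<Rightarrow> 'b measure \<Rightarrow> 'b set set topology" where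
  "malg_topology M m = Metric_space.mtopology (malg M) (malg_dist m)"

definition Sub :: "'a measure \<Rightarrow> ('a \<times> 'a) set \<Rightarrow> ('a \<times> 'a) set set set" where
  "Sub \<mu> R = {c \<in> malg (rel_measure \<mu> R). \<exists>S\<in>c. equiv (space \<mu>) S}"

lemma equiv_null_equiv: "equiv (sets M) (null_equiv M)"
proof (rule equivI)
  show "trans (null_equiv M)"
  proof (rule transI)
    fix A B C assume "(A, B) \<in> null_equiv M" "(B, C) \<in> null_equiv M"
    then have *: "A \<in> sets M" "C \<in> sets M" "sym_diff A B \<union> sym_diff B C \<in> null_sets M"
      by (auto simp: null_equiv_def)
    have "sym_diff A C \<in> null_sets M"
      by (rule null_sets_subset[OF *(3)]) (use * in auto)
    with * show "(A, C) \<in> null_equiv M"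
      by (auto simp: null_equiv_def)
  qed
qed (auto simp: null_equiv_def refl_on_def sym_def Un_commute)

lemma malg_rep:
  assumes "a \<in> malg M" shows "(SOME A. A \<in> a) \<in> a" "(SOME A. A \<in> a) \<in> sets M"
proof -
  have "a \<noteq> {}" "a \<subseteq> sets M"
    using assms equiv_null_equiv[of M] unfolding malg_def
    by (auto simp: in_quotient_imp_non_empty dest: in_quotient_imp_subset)
  then show "(SOME A. A \<in> a) \<in> a" by (simp add: some_in_eq)
  with \<open>a \<subseteq> sets M\<close> show "(SOME A. A \<in> a) \<in> sets M" by blast
qed

lemma malg_dist_eq:
  assumes m: "equivalent_finite_measure M m" and "a \<in> malg M" "b \<in> malg M" "A \<in> a" "B \<in> b"
  shows "malg_dist m a b = measure m (sym_diff A B)"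
proof -
  interpret finite_measure m using m by (simp add: equivalent_finite_measure_def)
  let ?A = "SOME A. A \<in> a" and ?B = "SOME B. B \<in> b"
  have "(?A, A) \<in> null_equiv M" "(?B, B) \<in> null_equiv M"
    using assms(4,5) malg_rep(1)[OF assms(2)] malg_rep(1)[OF assms(3)]
      in_quotient_imp_in_rel[OF equiv_null_equiv assms(2)[unfolded malg_def]]
      in_quotient_imp_in_rel[OF equiv_null_equiv assms(3)[unfolded malg_def]]
    by auto
  then have s: "sym_diff ?A A \<union> sym_diff ?B B \<in> null_sets m"
     and in_sets: "A \<in> sets m" "?A \<in> sets m" "B \<in> sets m" "?B \<in> sets m"
    using m by (auto simp: null_equiv_def equivalent_finite_measure_def)
  have "AE x in m. x \<in> sym_diff ?A ?B \<longleftrightarrow> x \<in> sym_diff A B"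
    by (rule AE_I'[OF s]) auto
  then have "measure m (sym_diff ?A ?B) = measure m (sym_diff A B)"
    using in_sets by (intro measure_eq_AE) auto
  then show ?thesis by (simp add: malg_dist_def)
qed

lemma Metric_space_malg:
  assumes m: "equivalent_finite_measure M m"
  shows "Metric_space (malg M) (malg_dist m)"
proof -
  interpret finite_measure m using m by (simp add: equivalent_finite_measure_def)
  have s: "sets m = sets M" and n: "null_sets m = null_sets M"
    using m by (auto simp: equivalent_finite_measure_def)
  show ?thesis
  proof
    show "0 \<le> malg_dist m a b" for a b by (simp add: malg_dist_def)
    show "malg_dist m a b = malg_dist m b a" for a b by (simp add: malg_dist_def Un_commute)
  next
    fix a b assume ab: "a \<in> malg M" "b \<in> malg M"
    note r = malg_rep[OF ab(1)] malg_rep[OF ab(2)]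
    let ?A = "SOME A. A \<in> a" and ?B = "SOME B. B \<in> b"
    have "malg_dist m a b = 0 \<longleftrightarrow> sym_diff ?A ?B \<in> null_sets m"
      using r s by (auto simp: malg_dist_def null_sets_def emeasure_eq_measure)
    also have "\<dots> \<longleftrightarrow> (?A, ?B) \<in> null_equiv M"
      using r n by (auto simp: null_equiv_def)
    also have "\<dots> \<longleftrightarrow> a = b"
      using quotient_eq_iff[OF equiv_null_equiv ab[unfolded malg_def] r(1) r(3)] by simp
    finally show "malg_dist m a b = 0 \<longleftrightarrow> a = b" .
  next
    fix a b c assume "a \<in> malg M" "b \<in> malg M" "c \<in> malg M"
    note r = this[THEN malg_rep(2)]
    let ?A = "SOME A. A \<in> a" and ?B = "SOME B. B \<in> b" and ?C = "SOME C. C \<in> c"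
    have "measure m (sym_diff ?A ?C) \<le> measure m (sym_diff ?A ?B \<union> sym_diff ?B ?C)"
      using r s by (intro finite_measure_mono) auto
    also have "\<dots> \<le> measure m (sym_diff ?A ?B) + measure m (sym_diff ?B ?C)"
      using r s by (intro measure_Un_le) auto
    finally show "malg_dist m a c \<le> malg_dist m a b + malg_dist m b c"
      by (simp add: malg_dist_def)
  qed
qed

end

theory Submission
  imports Defs
begin

text \<open>Rapidly convergent sequences of measurable sets converge in measure to their lower limit, and
  the lower limit of a sequence of equivalence relations on \<open>X\<close> is again an equivalence relation on
  \<open>X\<close>. Hence every Cauchy sequence of subrelations converges to a subrelation. Separability holds for
  the whole measure algebra, since a countably generated \<open>\<sigma>\<close>-algebra has a countable algebra of sets
  that is dense in measure.\<close>

section \<open>Countably generated sigma-algebras\<close>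

text \<open>Closing under pairwise unions and complements keeps a family countable; iterating this
  along the naturals gives increasing stages whose union is an algebra.\<close>

lemma countable_algebra_generated:
  assumes G: "countable G" "G \<subseteq> Pow \<Omega>"
  obtains \<A> where "countable \<A>" "G \<subseteq> \<A>" "\<A> \<subseteq> sigma_sets \<Omega> G" "algebra \<Omega> \<A>"
proof -
  define F where "F D = D \<union> (\<lambda>(a, b). a \<union> b) ` (D \<times> D) \<union> (\<lambda>a. \<Omega> - a) ` D" for D :: "'a set set"
  \<comment> \<open>The empty set is put in at stage 0, so that the algebra contains it even for
    empty \<open>G\<close>.\<close>
  define D where "D n = (F ^^ n) (insert {} G)" for n
  have D_Suc: "D (Suc n) = F (D n)" for n by (simp add: D_def)
  have mono: "D i \<subseteq> D j" if "i \<le> j" for i j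
    using that by (induction rule: dec_induct) (auto simp: D_Suc F_def)
  have "countable (D n)" for n
    by (induction n) (use G in \<open>auto simp: D_Suc F_def, simp add: D_def\<close>)
  moreover have *: "D n \<subseteq> sigma_sets \<Omega> G" for n
  proof (induction n)
    case 0
    then show ?case by (auto simp: D_def intro: sigma_sets.intros)
  next
    case (Suc n)
    then show ?case
      by (auto simp: D_Suc F_def intro!: sigma_sets_Un intro: sigma_sets.Compl)
  qed
  moreover have "algebra \<Omega> (\<Union>n. D n)"
    unfolding algebra_iff_Un
  proof (intro conjI ballI)
    show "(\<Union>n. D n) \<subseteq> Pow \<Omega>"
      using * sigma_sets_into_sp[OF G(2)] by blast
    show "{} \<in> (\<Union>n. D n)"
      by (rule UN_I[of 0]) (auto simp: D_def)
    show "\<Omega> - a \<in> (\<Union>n. D n)" if "a \<in> (\<Union>n. D n)" for a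
    proof -
      from that obtain n where "a \<in> D n" by blast
      then have "\<Omega> - a \<in> D (Suc n)" by (auto simp: D_Suc F_def)
      then show ?thesis by blast
    qed
    show "a \<union> b \<in> (\<Union>n. D n)" if "a \<in> (\<Union>n. D n)" "b \<in> (\<Union>n. D n)" for a b
    proof -
      from that obtain i j where "a \<in> D i" "b \<in> D j" by blast
      then have "a \<in> D (max i j)" "b \<in> D (max i j)"
        using mono[of i "max i j"] mono[of j "max i j"] by auto
      then have "a \<union> b \<in> D (Suc (max i j))" by (force simp: D_Suc F_def)
      then show ?thesis by blast
    qed
  qed
  moreover have "G \<subseteq> (\<Union>n. D n)"
    using UN_upper[of 0 UNIV D] by (auto simp: D_def)
  ultimately show thesis
    by (intro that[of "\<Union>n. D n"]) auto
qed

text \<open>Induction over the generation of the sigma-algebra: complements do not change a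
  symmetric difference, and a countable union is first cut to a finite one, by continuity of the
  finite measure from below.\<close>

lemma (in finite_measure) approx_by_generating_algebra:
  assumes "algebra (space M) \<A>" and gen: "sets M = sigma_sets (space M) \<A>"
    and A: "A \<in> sets M" and e: "e > 0"
  shows "\<exists>B\<in>\<A>. measure M (sym_diff A B) < e"
proof -
  interpret algebra "space M" \<A> by fact
  have sub: "\<A> \<subseteq> sets M" using gen by auto
  have "A \<in> sigma_sets (space M) \<A>" using A gen by simp
  then show ?thesis using e
  proof (induction arbitrary: e)
    case (Basic a)
    then show ?case by (intro bexI[of _ a]) auto
  next
    case Empty
    then show ?case by (intro bexI[of _ "{}"]) auto
  next
    case (Compl a)
    then obtain B where B: "B \<in> \<A>" "measure M (sym_diff a B) < e" by blast
    have "a \<subseteq> space M" "B \<subseteq> space M"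
      using Compl.hyps B(1) sets.sets_into_space gen sub by blast+
    then have "sym_diff (space M - a) (space M - B) = sym_diff a B" by auto
    then show ?case using B by (intro bexI[of _ "space M - B"]) auto
  next
    case (Union a)
    have a: "a i \<in> sets M" for i using Union.hyps gen by simp
    have "(\<lambda>n. measure M (\<Union>i\<le>n. a i)) \<longlonglongrightarrow> measure M (\<Union>n. \<Union>i\<le>n. a i)"
      using a by (intro finite_Lim_measure_incseq) (auto simp: incseq_def, force)
    also have "(\<Union>n. \<Union>i\<le>n. a i) = (\<Union>i. a i)" by auto
    finally have "eventually (\<lambda>n. measure M (\<Union>i. a i) - e/2 < measure M (\<Union>i\<le>n. a i)) sequentially"
      using Union.prems by (intro order_tendstoD) auto
    then obtain n where n: "measure M (\<Union>i. a i) - e/2 < measure M (\<Union>i\<le>n. a i)"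
      by (auto simp: eventually_sequentially)
    \<comment> \<open>The truncated union has \<open>Suc n\<close> members, so these errors add up
      to at most \<open>e / 2\<close>; the cut-off tail costs the other half.\<close>
    have "\<forall>i. \<exists>B\<in>\<A>. measure M (sym_diff (a i) B) < e / (2 * Suc n)"
      using Union.IH Union.prems by simp
    then obtain B where B: "\<And>i. B i \<in> \<A>" "\<And>i. measure M (sym_diff (a i) (B i)) < e / (2 * Suc n)"
      by metis
    have Bm: "B i \<in> sets M" for i using B(1) sub by blast
    let ?B = "\<Union>i\<le>n. B i"
    have "measure M (sym_diff (\<Union>i. a i) ?B) \<le>
        measure M (((\<Union>i. a i) - (\<Union>i\<le>n. a i)) \<union> (\<Union>i\<le>n. sym_diff (a i) (B i)))"
      using a Bm by (intro finite_measure_mono) (blast, auto)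
    also have "\<dots> \<le> measure M ((\<Union>i. a i) - (\<Union>i\<le>n. a i)) + measure M (\<Union>i\<le>n. sym_diff (a i) (B i))"
      using a Bm by (intro measure_Un_le) auto
    also have "measure M ((\<Union>i. a i) - (\<Union>i\<le>n. a i)) = measure M (\<Union>i. a i) - measure M (\<Union>i\<le>n. a i)"
      using a by (intro finite_measure_Diff) auto
    also have "\<dots> < e / 2" using n by simp
    also have "measure M (\<Union>i\<le>n. sym_diff (a i) (B i)) \<le> (\<Sum>i\<le>n. measure M (sym_diff (a i) (B i)))"
      using a Bm by (intro measure_UNION_le) auto
    also have "\<dots> \<le> (\<Sum>i\<le>n. e / (2 * Suc n))"
      using B(2) by (intro sum_mono less_imp_le)
    also have "\<dots> = e / 2" by (simp add: field_simps)
    finally have "measure M (sym_diff (\<Union>i. a i) ?B) < e" by simp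
    moreover have "?B \<in> \<A>" using B(1) by auto
    ultimately show ?case by blast
  qed
qed

section \<open>Separability of measure algebras\<close>

text \<open>Balls of radius \<open>1 / Suc n\<close> about the points of a countable dense set form
  a base. Second countability is wanted because it passes to every subspace, and because it makes
  the Borel sets of a Polish space countably generated.\<close>

lemma (in Metric_space) separable_imp_second_countable:
  assumes "separable_space mtopology"
  shows "second_countable mtopology"
proof -
  obtain C where C: "countable C" "C \<subseteq> M" "mtopology closure_of C = M"
    using assms by (auto simp: separable_space_def)
  let ?B = "(\<lambda>(c, n). mball c (1 / real (Suc n))) ` (C \<times> UNIV)"
  have "\<exists>V\<in>?B. x \<in> V \<and> V \<subseteq> U" if U: "openin mtopology U" and x: "x \<in> U" for U x
  proof -
    obtain r where r: "r > 0" "mball x r \<subseteq> U" and xM: "x \<in> M"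
      using U x unfolding openin_mtopology by blast
    obtain n where n: "1 / real (Suc n) < r / 2"
      using r nat_approx_posE[of "r / 2"] by auto
    have "x \<in> mtopology closure_of C" using C xM by simp
    then obtain c where c: "c \<in> C" "c \<in> mball x (1 / real (Suc n))"
      by (auto simp: metric_closure_of dest!: spec[of _ "1 / real (Suc n)"])
    have "mball c (1 / real (Suc n)) \<subseteq> mball x r"
    proof
      fix y assume y: "y \<in> mball c (1 / real (Suc n))"
      then have "d x y \<le> d x c + d c y" using c xM by (intro triangle) auto
      then show "y \<in> mball x r" using y c n xM by auto
    qed
    moreover have "x \<in> mball c (1 / real (Suc n))" using c by (auto simp: commute)
    ultimately show ?thesis using c(1) r(2) by blast
  qed
  moreover have "countable ?B" using C by auto
  ultimately show ?thesis
    unfolding second_countable_def by (intro exI[of _ ?B]) auto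
qed

lemma class_in_malg: "A \<in> sets M \<Longrightarrow> null_equiv M `` {A} \<in> malg M"
  by (simp add: malg_def quotientI)

lemma self_in_class: "A \<in> sets M \<Longrightarrow> A \<in> null_equiv M `` {A}"
  using equiv_class_self[OF equiv_null_equiv] .

lemma malg_elem_sets: "a \<in> malg M \<Longrightarrow> A \<in> a \<Longrightarrow> A \<in> sets M"
  using in_quotient_imp_subset[OF equiv_null_equiv] unfolding malg_def by blast

text \<open>The classes of a countable algebra generating the measurable sets are dense, since such
  an algebra approximates every measurable set in \<open>m\<close>.\<close>

lemma second_countable_malg:
  assumes m: "equivalent_finite_measure M m"
    and G: "countable G" "G \<subseteq> Pow (space M)" "sets M = sigma_sets (space M) G"
  shows "second_countable (malg_topology M m)"
proof -
  interpret finite_measure m using m by (simp add: equivalent_finite_measure_def)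
  interpret Metric_space "malg M" "malg_dist m" by (rule Metric_space_malg[OF m])
  have s: "sets m = sets M" and sp: "space m = space M"
    using m by (auto simp: equivalent_finite_measure_def dest: sets_eq_imp_space_eq)
  obtain \<A> where \<A>: "countable \<A>" "G \<subseteq> \<A>" "\<A> \<subseteq> sigma_sets (space M) G" "algebra (space M) \<A>"
    using countable_algebra_generated[OF G(1,2)] by blast
  have gen: "sets m = sigma_sets (space m) \<A>"
    using \<A> G(3) s sp
    by (metis sigma_sets_eqI sigma_sets.Basic subsetD)
  let ?cl = "\<lambda>A. null_equiv M `` {A}"
  have sub: "\<A> \<subseteq> sets M" using \<A> G by simp
  have "mtopology closure_of (?cl ` \<A>) = malg M"
  proof (intro equalityI subsetI)
    fix a assume a: "a \<in> malg M"
    note rep = malg_rep[OF a]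
    have "\<exists>y\<in>?cl ` \<A>. y \<in> mball a r" if r: "r > 0" for r
    proof -
      obtain B where B: "B \<in> \<A>" "measure m (sym_diff (SOME A. A \<in> a) B) < r"
        using approx_by_generating_algebra[OF _ gen _ r] \<A>(4) sp s rep(2) by force
      have "malg_dist m a (?cl B) < r"
        using malg_dist_eq[OF m a class_in_malg rep(1) self_in_class] B sub by auto
      then show ?thesis using a B sub class_in_malg by auto
    qed
    then show "a \<in> mtopology closure_of (?cl ` \<A>)" using a by (simp add: metric_closure_of)
  qed (auto simp: metric_closure_of)
  then have "separable_space mtopology"
    unfolding separable_space_def using \<A>(1) sub class_in_malg
    by (intro exI[of _ "?cl ` \<A>"]) auto
  then show ?thesis
    unfolding malg_topology_def by (rule separable_imp_second_countable)
qed

section \<open>Completeness and lower limits\<close>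

text \<open>A point outside all consecutive differences from stage \<open>N\<close> on has constant
  membership from there, so \<open>A N\<close> and the lower limit agree at it. Hence the difference
  is covered by the sets \<open>?D k\<close>, and the geometric tail starting at \<open>N\<close>
  bounds its measure.\<close>

lemma (in finite_measure) measure_diff_lower_limit:
  fixes A :: "nat \<Rightarrow> 'a set"
  assumes A: "\<And>n. A n \<in> sets M"
    and fast: "\<And>n. measure M (sym_diff (A n) (A (Suc n))) \<le> (1/2) ^ n"
  shows "measure M (sym_diff (A N) (\<Union>n. \<Inter>k\<in>{n..}. A k)) \<le> 2 * (1/2) ^ N"
proof -
  let ?D = "\<lambda>k. sym_diff (A (k + N)) (A (Suc (k + N)))"
  let ?L = "\<Union>n. \<Inter>k\<in>{n..}. A k"
  have geo: "summable (\<lambda>k. (1/2) ^ (k + N) :: real)"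
    by (simp add: power_add summable_mult2 summable_geometric)
  have le: "measure M (?D k) \<le> (1/2) ^ (k + N)" for k using fast by simp
  have sum: "summable (\<lambda>k. measure M (?D k))"
    by (rule summable_comparison_test'[OF geo, of 0]) (simp only: real_norm_def abs_of_nonneg[OF measure_nonneg] le)
  have "sym_diff (A N) ?L \<subseteq> (\<Union>k. ?D k)"
  proof (rule ccontr)
    assume "\<not> ?thesis"
    then obtain x where x: "x \<in> sym_diff (A N) ?L" "\<And>k. x \<notin> ?D k" by blast
    have "x \<in> A (k + N) \<longleftrightarrow> x \<in> A N" for k
      by (induction k) (use x(2) in auto)
    then have const: "x \<in> A k \<longleftrightarrow> x \<in> A N" if "k \<ge> N" for k
      using that by (metis le_add_diff_inverse2)
    have "x \<in> A N" if "x \<in> ?L"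
    proof -
      from that obtain n where "\<And>k. k \<ge> n \<Longrightarrow> x \<in> A k" by auto
      then show ?thesis using const[of "max n N"] by simp
    qed
    moreover have "x \<in> ?L" if "x \<in> A N" using const that by auto
    ultimately show False using x(1) by blast
  qed
  then have "measure M (sym_diff (A N) ?L) \<le> measure M (\<Union>k. ?D k)"
    using A by (intro finite_measure_mono) auto
  also have "\<dots> \<le> (\<Sum>k. measure M (?D k))"
    using A sum by (intro finite_measure_subadditive_countably) auto
  also have "\<dots> \<le> (\<Sum>k. (1/2) ^ (k + N))"
    using le sum geo by (rule suminf_le)
  also have "\<dots> = 2 * (1/2) ^ N"
    by (simp add: power_add suminf_mult2[symmetric] summable_geometric suminf_geometric)
  finally show ?thesis .
qed

text \<open>Completeness by way of exact representatives: a rapidly convergent subsequence is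
  represented by sets in \<open>K\<close>, and the class of their lower limit is the limit of the
  whole Cauchy sequence.\<close>

lemma mcomplete_malg_subset:
  assumes m: "equivalent_finite_measure M m"
    and lower: "\<And>A :: nat \<Rightarrow> _. (\<And>n. A n \<in> K) \<Longrightarrow> (\<Union>n. \<Inter>k\<in>{n..}. A k) \<in> K"
  shows "Metric_space.mcomplete {c \<in> malg M. \<exists>S\<in>c. S \<in> K} (malg_dist m)" (is "Metric_space.mcomplete ?C _")
proof -
  interpret finite_measure m using m by (simp add: equivalent_finite_measure_def)
  interpret Metric_space "malg M" "malg_dist m" by (rule Metric_space_malg[OF m])
  have s: "sets m = sets M" using m by (auto simp: equivalent_finite_measure_def)
  interpret S: Metric_space ?C "malg_dist m" by (rule subspace) auto
  show ?thesis
    unfolding S.mcomplete_def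
  proof (intro allI impI)
    fix \<sigma> assume \<sigma>: "S.MCauchy \<sigma>"
    let ?P = "\<lambda>n k. \<forall>i\<ge>k. \<forall>j\<ge>k. malg_dist m (\<sigma> i) (\<sigma> j) < (1/2) ^ n"
    \<comment> \<open>Every large index qualifies, so the dependent choice below can take one beyond
      its predecessor and make \<open>r\<close> strictly increasing.\<close>
    have P: "\<exists>N. \<forall>k\<ge>N. ?P n k" for n
    proof -
      obtain N where "\<And>i j. i \<ge> N \<Longrightarrow> j \<ge> N \<Longrightarrow> malg_dist m (\<sigma> i) (\<sigma> j) < (1/2) ^ n"
        using \<sigma> unfolding S.MCauchy_def by (metis half_gt_zero_iff zero_less_one zero_less_power)
      then show ?thesis by (meson le_trans)
    qed
    have "\<exists>r :: nat \<Rightarrow> nat. \<forall>n. ?P n (r n) \<and> r n < r (Suc n)"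
    proof (rule dependent_nat_choice)
      show "\<exists>k. ?P 0 k" using P[of 0] by blast
      fix k n
      obtain N where "\<forall>k\<ge>N. ?P (Suc n) k" using P by blast
      then have "?P (Suc n) (max N (Suc k))" using max.cobounded1 by blast
      then show "\<exists>k'. ?P (Suc n) k' \<and> k < k'"
        by (intro exI[of _ "max N (Suc k)"] conjI) (assumption, simp)
    qed
    then obtain r where r: "\<And>n. ?P n (r n)" "\<And>n. r n < r (Suc n)" by blast
    have mono: "strict_mono r" using r(2) by (simp add: strict_mono_Suc_iff)
    have \<sigma>C: "\<sigma> n \<in> ?C" for n using \<sigma> by (auto simp: S.MCauchy_def)
    \<comment> \<open>Representatives are taken inside \<open>K\<close>, since an arbitrary choice
      would give a lower limit that is in \<open>K\<close> only up to a null set.\<close>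
    then have "\<forall>n. \<exists>A. A \<in> \<sigma> (r n) \<and> A \<in> K" by blast
    then obtain A where A: "\<And>n. A n \<in> \<sigma> (r n)" "\<And>n. A n \<in> K" by metis
    have sets: "A n \<in> sets M" for n using malg_elem_sets[OF _ A(1)] \<sigma>C by auto
    let ?L = "\<Union>n. \<Inter>k\<in>{n..}. A k"
    have L: "?L \<in> sets M" using sets by auto
    let ?l = "null_equiv M `` {?L}"
    have lC: "?l \<in> ?C"
      by (intro CollectI conjI bexI[of _ ?L] class_in_malg self_in_class lower L A(2))
    have fast: "measure m (sym_diff (A n) (A (Suc n))) \<le> (1/2) ^ n" for n
    proof -
      have "malg_dist m (\<sigma> (r n)) (\<sigma> (r (Suc n))) < (1/2) ^ n"
        using r(1)[of n] r(2)[of n] by (auto dest: less_imp_le)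
      then show ?thesis
        using malg_dist_eq[OF m _ _ A(1)[of n] A(1)[of "Suc n"]] \<sigma>C by auto
    qed
    have dist: "malg_dist m (\<sigma> (r n)) ?l \<le> 2 * (1/2) ^ n" for n
      using measure_diff_lower_limit[OF _ fast] sets s
        malg_dist_eq[OF m _ class_in_malg[OF L] A(1) self_in_class[OF L], of n] \<sigma>C by auto
    have "(\<lambda>n. malg_dist m (\<sigma> (r n)) ?l) \<longlonglongrightarrow> 0"
    proof (rule tendsto_sandwich[of "\<lambda>_. 0" _ _ "\<lambda>n. 2 * (1/2) ^ n"])
      show "(\<lambda>n. 2 * (1/2) ^ n :: real) \<longlonglongrightarrow> 0"
        by (intro tendsto_mult_right_zero LIMSEQ_power_zero) simp
    qed (use dist in \<open>auto\<close>)
    then have "limitin S.mtopology (\<sigma> \<circ> r) ?l sequentially"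
      using lC \<sigma>C by (simp add: S.limitin_metric_dist_null)
    \<comment> \<open>A Cauchy sequence with a convergent subsequence converges to the same
      limit.\<close>
    then show "\<exists>x. limitin S.mtopology \<sigma> x sequentially"
      using S.MCauchy_convergent_subsequence[OF \<sigma> mono] by blast
  qed
qed

text \<open>Transitivity is the reason for the lower limit: two pairs that both lie in eventually
  all \<open>S k\<close> do so simultaneously from some index on. In an upper limit they might occur
  along disjoint sets of indices.\<close>

lemma equiv_lower_limit:
  fixes S :: "nat \<Rightarrow> ('a \<times> 'a) set"
  assumes "\<And>n. equiv X (S n)"
  shows "equiv X (\<Union>n. \<Inter>k\<in>{n..}. S k)" (is "equiv X ?L")
proof (rule equivI)
  show "?L \<subseteq> X \<times> X" using assms by (fastforce simp: equiv_def)
  show "refl_on X ?L" using assms by (fastforce simp: equiv_def refl_on_def)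
  have "sym (S n)" for n using assms by (simp add: equiv_def)
  then show "sym ?L" by (auto intro!: symI dest: symD)
  show "trans ?L"
  proof (rule transI)
    fix x y z assume "(x, y) \<in> ?L" "(y, z) \<in> ?L"
    then obtain i j where "\<And>k. k \<ge> i \<Longrightarrow> (x, y) \<in> S k" "\<And>k. k \<ge> j \<Longrightarrow> (y, z) \<in> S k" by auto
    then have "(x, z) \<in> S k" if "k \<ge> max i j" for k
      using that assms[of k] by (meson equiv_def max.bounded_iff transD)
    then show "(x, z) \<in> ?L" by (intro UN_I[of "max i j"] INT_I) (simp_all only: UNIV_I atLeast_iff)
  qed
qed

section \<open>The space of subrelations\<close>

lemma polish_second_countable: "polish_topology T \<Longrightarrow> second_countable T"
  unfolding polish_topology_def completely_metrizable_space_def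
  using Metric_space.separable_imp_second_countable by blast

text \<open>A countable base of the Polish topology generates, because each open set is a countable
  union of base members.\<close>

lemma standard_borel_countably_generated:
  assumes "standard_borel \<mu>"
  obtains G where "countable G" "G \<subseteq> Pow (space \<mu>)" "sets \<mu> = sigma_sets (space \<mu>) G"
proof -
  obtain T where T: "polish_topology T" "topspace T = space \<mu>"
      "sets \<mu> = sigma_sets (space \<mu>) {U. openin T U}"
    using assms by (auto simp: standard_borel_def)
  obtain B where B: "countable B" "\<And>V. V \<in> B \<Longrightarrow> openin T V"
      "\<And>U x. openin T U \<Longrightarrow> x \<in> U \<Longrightarrow> \<exists>V\<in>B. x \<in> V \<and> V \<subseteq> U"
    using polish_second_countable[OF T(1)] unfolding second_countable_def by metis
  have sp: "B \<subseteq> Pow (space \<mu>)" using B(2) openin_subset T(2) by blast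
  have "sets \<mu> = sigma_sets (space \<mu>) B"
    unfolding T(3)
  proof (rule sigma_sets_eqI)
    fix U assume "U \<in> {U. openin T U}"
    then have "U = \<Union>{V \<in> B. V \<subseteq> U}" using B(3) by blast
    moreover have "\<Union>{V \<in> B. V \<subseteq> U} \<in> sigma_sets (space \<mu>) B"
      by (rule sigma_sets_UNION) (use B(1) in auto)
    ultimately show "U \<in> sigma_sets (space \<mu>) B" by simp
  qed (use B(2) in auto)
  then show thesis using that B(1) sp by blast
qed

text \<open>Products of generators of the factor generate the product sigma-algebra, and their
  traces on \<open>R\<close> generate the restricted one. \<open>measure_of\<close> takes its
  measurable sets from this family, whatever its set function.\<close>

lemma rel_measure_countably_generated:
  assumes "standard_borel \<mu>" and R: "R \<in> sets (\<mu> \<Otimes>\<^sub>M \<mu>)"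
  obtains G where "countable G" "G \<subseteq> Pow R" "sets (rel_measure \<mu> R) = sigma_sets R G"
proof -
  obtain E where E: "countable E" "E \<subseteq> Pow (space \<mu>)" "sets \<mu> = sigma_sets (space \<mu>) E"
    using standard_borel_countably_generated[OF assms(1)] .
  \<comment> \<open>With the whole space among the generators, the singleton
    \<open>{space \<mu>}\<close> is the countable cover that \<open>sets_pair_eq\<close> asks for in
    each factor.\<close>
  define E' where "E' = insert (space \<mu>) E"
  have E': "countable E'" "E' \<subseteq> Pow (space \<mu>)" using E by (auto simp: E'_def)
  have "sets \<mu> = sigma_sets (space \<mu>) E'"
    unfolding E(3) E'_def
    by (rule sigma_sets_eqI) (auto intro: sigma_sets_top)
  let ?P = "{a \<times> b |a b. a \<in> E' \<and> b \<in> E'}"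
  have "sets (\<mu> \<Otimes>\<^sub>M \<mu>) = sets (sigma (space \<mu> \<times> space \<mu>) ?P)"
    using E' \<open>sets \<mu> = sigma_sets (space \<mu>) E'\<close>
    by (intro sets_pair_eq[where Ca = "{space \<mu>}" and Cb = "{space \<mu>}"]) (auto simp: E'_def)
  also have "\<dots> = sigma_sets (space \<mu> \<times> space \<mu>) ?P"
    using E'(2) by (intro sets_measure_of) auto
  finally have P: "sets (\<mu> \<Otimes>\<^sub>M \<mu>) = sigma_sets (space \<mu> \<times> space \<mu>) ?P" .
  have RX: "R \<subseteq> space \<mu> \<times> space \<mu>" using sets.sets_into_space[OF R] by (simp add: space_pair_measure)
  have sub: "sets (restrict_space (\<mu> \<Otimes>\<^sub>M \<mu>) R) = sigma_sets R ((\<inter>) R ` ?P)"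
    unfolding sets_restrict_space P
    by (rule sigma_sets_Int) (use R RX P in auto)
  have "sets (rel_measure \<mu> R) = sigma_sets R (sets (restrict_space (\<mu> \<Otimes>\<^sub>M \<mu>) R))"
    unfolding rel_measure_def by (rule sets_measure_of) (auto simp: sets_restrict_space)
  also have "\<dots> = sigma_sets R ((\<inter>) R ` ?P)"
    unfolding sub by (rule sigma_sets_sigma_sets_eq) auto
  finally have "sets (rel_measure \<mu> R) = sigma_sets R ((\<inter>) R ` ?P)" .
  moreover have "countable ((\<inter>) R ` ?P)"
  proof -
    have "?P = (\<lambda>(a, b). a \<times> b) ` (E' \<times> E')" by auto
    then show ?thesis using E'(1) by auto
  qed
  ultimately show thesis using that[of "(\<inter>) R ` ?P"] by auto
qed

theorem theorem1:
  fixes \<mu> :: "'a measure" and R :: "('a \<times> 'a) set" and m :: "('a \<times> 'a) measure"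
  assumes "standard_prob_space \<mu>"
    and "cber \<mu> R"
    and "nonsingular \<mu> R"
    and "equivalent_finite_measure (rel_measure \<mu> R) m"
  shows "polish_topology (subtopology (malg_topology (rel_measure \<mu> R) m) (Sub \<mu> R))"
proof -
  let ?M = "rel_measure \<mu> R"
  interpret Metric_space "malg ?M" "malg_dist m" by (rule Metric_space_malg[OF assms(4)])
  have Sub_subset: "Sub \<mu> R \<subseteq> malg ?M" by (auto simp: Sub_def)
  interpret S: Submetric "malg ?M" "malg_dist m" "Sub \<mu> R"
    by unfold_locales (rule Sub_subset)
  \<comment> \<open>Here \<open>K\<close> consists of the equivalence relations on all of
    \<open>space \<mu>\<close>, so that \<open>?C\<close> becomes
    \<open>Sub \<mu> R\<close>.\<close>
  have "S.sub.mcomplete"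
    using mcomplete_malg_subset[OF assms(4), of "{S. equiv (space \<mu>) S}"]
      equiv_lower_limit[of "space \<mu>"]
    unfolding Sub_def mem_Collect_eq by blast
  then have "completely_metrizable_space (subtopology mtopology (Sub \<mu> R))"
    by (metis S.mtopology_submetric S.sub.completely_metrizable_space_mtopology)
  moreover obtain G where G: "countable G" "G \<subseteq> Pow R" "sets ?M = sigma_sets R G"
    using rel_measure_countably_generated assms(1,2)
    unfolding standard_prob_space_def cber_def by metis
  have "space ?M = R"
    by (simp add: rel_measure_def space_measure_of_conv)
  then have "second_countable (malg_topology ?M m)"
    using second_countable_malg[OF assms(4)] G by simp
  \<comment> \<open>Separability need not pass to subspaces of a general topological space, so the
    restriction is made at the level of second countability.\<close>
  then have "separable_space (subtopology (malg_topology ?M m) (Sub \<mu> R))"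
    by (intro second_countable_imp_separable_space second_countable_subtopology)
  ultimately show ?thesis
    by (simp add: polish_topology_def malg_topology_def)
qed

end
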